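(* Let $n\ge 5$ be an odd integer, let $D=D(H_n)$ be the distance matrix of the helm graph $H_n$, and let $\mathbf{w}=\frac14\left(5-n,\,-\mathbf{e}',\,2\mathbf{e}'\right)'\in\mathbb{R}^{2n-1}$, where $\mathbf{e}\in\mathbb{R}^{n-1}$ is the all-ones vector. Let $$L=\begin{bmatrix}\frac{n-1}{2} & -\frac12\mathbf{e}' & \mathbf{0}'\\ -\frac12\mathbf{e} & A & B\\ \mathbf{0} & B & I_{n-1}\end{bmatrix},$$ where $A=\mathrm{Circ}(\mathbf{x}')$ and $B=\mathrm{Circ}(\mathbf{y}')$ are the circulant matrices of order $n-1$ defined in the context. Then the Moore-Penrose inverse of $D$ is $$D^{\dagger}=-\frac12 L+\frac{4}{3(n-1)}\mathbf{w}\mathbf{w}'.$$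
   Context: A prime denotes transpose; $\mathbf{e}$ and $\mathbf{0}$ are the all-ones and zero column vectors (here in $\mathbb{R}^{n-1}$), $J_{n-1}$ is the all-ones matrix and $I_{n-1}$ the identity matrix of order $n-1$. For $\mathbf{a}=(a_1,\dots,a_N)'\in\mathbb{R}^N$, $\mathrm{Circ}(\mathbf{a}')$ is the $N\times N$ circulant matrix with first row $(a_1,a_2,\dots,a_N)$, each subsequent row being the previous row cyclically shifted one place to the right. Helm graph: for $n\ge4$, the wheel $W_n$ consists of a cycle on $v_1,\dots,v_{n-1}$ together with a vertex $v_0$ adjacent to all $v_i$; the helm graph $H_n$ (on $2n-1$ vertices) is obtained from $W_n$ by attaching to each $v_i$, $1\le i\le n-1$, a pendant vertex $u_i$. The distance matrix $D(H_n)$ has as entries the shortest-path distances, with vertices ordered $v_0,v_1,\dots,v_{n-1},u_1,\dots,u_{n-1}$. Explicitly, $$D(H_n)=\begin{bmatrix}0&\mathbf{e}'&2\mathbf{e}'\\ \mathbf{e}&2J_{n-1}-S&3J_{n-1}-S\\ 2\mathbf{e}&3J_{n-1}-S&4J_{n-1}-S-2I_{n-1}\end{bmatrix},\quad S=\mathrm{Circ}(\mathbf{s}'),\ \mathbf{s}=(2,1,0,\dots,0,1)'\in\mathbb{R}^{n-1}.$$ Vectors $\mathbf{x},\mathbf{y}$ (for odd $n\ge5$): put $m=\frac{n-1}{2}$ and, for $1\le k\le m$, $\alpha_k=(-1)^{k+1}\left[2m^2-6(m-k)^2+7\right]$. Then $$\mathbf{x}=\frac{1}{6(n-1)}(n^2+4n-12,\alpha_1,\alpha_2,\dots,\alpha_{m-1},\alpha_m,\alpha_{m-1},\dots,\alpha_2,\alpha_1)'\in\mathbb{R}^{n-1},$$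 $$\mathbf{y}=\frac{1}{n-1}(2-n,-1,1,-1,1,\dots,-1,1,-1)'\in\mathbb{R}^{n-1}.$$ The Moore-Penrose inverse $M^\dagger$ of a real matrix $M$ is the unique $X$ with $MXM=M$, $XMX=X$, $(MX)'=MX$, $(XM)'=XM$. *)

theory Defs
  imports
    "Jordan_Normal_Form.Matrix"
    "Graph_Theory.Pair_Digraph"
    "Graph_Theory.Shortest_Path"
begin

definition circ :: "'a vec \<Rightarrow> 'a mat" where
  "circ a = (let N = dim_vec a in mat N N (\<lambda>(i, j). a $ ((j + N - i) mod N)))"

definition is_MP_inverse :: "real mat \<Rightarrow> real mat \<Rightarrow> bool" where
  "is_MP_inverse M X \<longleftrightarrow>
     X \<in> carrier_mat (dim_col M) (dim_row M) \<and>
     M * X * M = M \<and>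
     X * M * X = X \<and>
     (M * X)\<^sup>T = M * X \<and>
     (X * M)\<^sup>T = X * M"

definition MP_inverse :: "real mat \<Rightarrow> real mat" where
  "MP_inverse M = (THE X. is_MP_inverse M X)"


text \<open>The vertices \<open>v\<^sub>0\<close>, \<open>v\<^sub>i\<close> and \<open>u\<^sub>i\<close> (with \<open>1 \<le> i \<le> n - 1\<close>) of the helm graph are
  \<open>Hub\<close>, \<open>Rim i\<close> and \<open>Pendant i\<close>.\<close>

datatype helm_vertex = Hub | Rim nat | Pendant nat

text \<open>Each undirected edge is listed once here, in an arbitrary orientation.\<close>

definition wheel_edges :: "nat \<Rightarrow> (helm_vertex \<times> helm_vertex) set" where
  "wheel_edges n =
     {(Hub, Rim i) | i. 1 \<le> i \<and> i \<le> n - 1} \<union>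
     {(Rim i, Rim (Suc i)) | i. 1 \<le> i \<and> i < n - 1} \<union>
     {(Rim (n - 1), Rim 1)}"

definition helm_edges :: "nat \<Rightarrow> (helm_vertex \<times> helm_vertex) set" where
  "helm_edges n = wheel_edges n \<union> {(Rim i, Pendant i) | i. 1 \<le> i \<and> i \<le> n - 1}"

definition helm_graph :: "nat \<Rightarrow> helm_vertex pair_pre_digraph" where
  "helm_graph n =
     \<lparr> pverts = {Hub} \<union> Rim ` {1..n - 1} \<union> Pendant ` {1..n - 1},
       parcs = helm_edges n \<union> (helm_edges n)\<inverse> \<rparr>"

lemma pair_graph_helm_graph:
  assumes "n \<ge> 4"
  shows "pair_graph (helm_graph n)"
proof
  have sub: "helm_edges n \<subseteq> pverts (helm_graph n) \<times> pverts (helm_graph n)"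
    using assms by (auto simp: helm_graph_def helm_edges_def wheel_edges_def)
  then show "fst e \<in> pverts (helm_graph n)" "snd e \<in> pverts (helm_graph n)"
    if "e \<in> parcs (helm_graph n)" for e
    using that by (auto simp: helm_graph_def)
  show fin: "finite (pverts (helm_graph n))"
    by (simp add: helm_graph_def)
  then have "finite (helm_edges n)"
    using sub by (meson finite_SigmaI finite_subset)
  then show "finite (parcs (helm_graph n))"
    by (simp add: helm_graph_def)
  show "fst e \<noteq> snd e" if "e \<in> parcs (helm_graph n)" for e
    using that assms by (auto simp: helm_graph_def helm_edges_def wheel_edges_def)
  show "symmetric (with_proj (helm_graph n))"
    by (auto simp: symmetric_def sym_def helm_graph_def)
qed

text \<open>The ordering \<open>v\<^sub>0, v\<^sub>1, \<dots>, v\<^sub>n\<^sub>-\<^sub>1, u\<^sub>1, \<dots>, u\<^sub>n\<^sub>-\<^sub>1\<close>, indexed from \<open>0\<close> to \<open>2 * n - 2\<close>.\<close>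

definition helm_vertex_at :: "nat \<Rightarrow> nat \<Rightarrow> helm_vertex" where
  "helm_vertex_at n i =
     (if i = 0 then Hub else if i \<le> n - 1 then Rim i else Pendant (i - (n - 1)))"

text \<open>With unit weights, \<open>wf_digraph.\<mu>\<close> is the minimal number of arcs of a walk. It is always
  finite here, since the helm graph is connected.\<close>

definition helm_dist_mat :: "nat \<Rightarrow> real mat" where
  "helm_dist_mat n = mat (2 * n - 1) (2 * n - 1) (\<lambda>(i, j).
     real_of_ereal (wf_digraph.\<mu> (with_proj (helm_graph n)) (\<lambda>_. 1)
       (helm_vertex_at n i) (helm_vertex_at n j)))"


definition ones_vec :: "nat \<Rightarrow> real vec" where
  "ones_vec N = vec N (\<lambda>_. 1)"

definition helm_alpha :: "nat \<Rightarrow> nat \<Rightarrow> real" where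
  "helm_alpha m k = (-1) ^ (k + 1) * (2 * (real m)\<^sup>2 - 6 * (real m - real k)\<^sup>2 + 7)"

text \<open>Positions \<open>1, \<dots>, n - 2\<close> of \<open>x\<close> read
  \<open>\<alpha>\<^sub>1, \<dots>, \<alpha>\<^sub>m\<^sub>-\<^sub>1, \<alpha>\<^sub>m, \<alpha>\<^sub>m\<^sub>-\<^sub>1, \<dots>, \<alpha>\<^sub>1\<close>, where \<open>n - 1 = 2 * m\<close>.\<close>

definition helm_x :: "nat \<Rightarrow> real vec" where
  "helm_x n = (let m = (n - 1) div 2 in
     (1 / (6 * (real n - 1))) \<cdot>\<^sub>v vec (n - 1) (\<lambda>k.
       if k = 0 then (real n)\<^sup>2 + 4 * real n - 12
       else if k \<le> m then helm_alpha m k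
       else helm_alpha m (n - 1 - k)))"

definition helm_y :: "nat \<Rightarrow> real vec" where
  "helm_y n = (1 / (real n - 1)) \<cdot>\<^sub>v vec (n - 1) (\<lambda>k.
     if k = 0 then 2 - real n else (-1) ^ k)"

definition helm_w :: "nat \<Rightarrow> real vec" where
  "helm_w n = (1 / 4) \<cdot>\<^sub>v
     vCons (5 - real n) (- ones_vec (n - 1) @\<^sub>v 2 \<cdot>\<^sub>v ones_vec (n - 1))"

definition helm_L :: "nat \<Rightarrow> real mat" where
  "helm_L n = (let
     A = circ (helm_x n);
     B = circ (helm_y n);
     r = mat_of_row ((- (1 / 2)) \<cdot>\<^sub>v ones_vec (n - 1) @\<^sub>v 0\<^sub>v (n - 1))
   in four_block_mat
        (mat 1 1 (\<lambda>_. (real n - 1) / 2)) r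
        r\<^sup>T                               (four_block_mat A B B (1\<^sub>m (n - 1))))"

end

theory Submission
  imports Defs
begin

text \<open>Put \<open>N = n - 1\<close> and \<open>z = (0, 1, -1, \<dots>, 1, -1, 0, \<dots>, 0)'\<close>, the alternating vector on the rim.
  Every block of \<open>D\<close> is a combination of all-ones, identity and \<open>S\<close>, and \<open>S\<close> annihilates
  alternating vectors while taking a second difference (up to sign) of \<open>(-1)\<^sup>k q(k)\<close> for
  quadratic \<open>q\<close>. This gives \<open>D L = 2 (e w' - I + z z' / N)\<close>, and with \<open>D w = (3N/4) e\<close> the
  claimed inverse \<open>X\<close> satisfies \<open>D X = I - z z' / N\<close>. As \<open>D\<close>, \<open>X\<close> and this projection are
  symmetric and \<open>D z = X z = 0\<close>, the Penrose equations follow.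

  The graph distances are certified by a potential function: it drops by at most one along
  each arc and every vertex other than the target has an arc along which it decreases by one.\<close>

section \<open>Shortest walks from potential functions\<close>

lemma (in wf_digraph) mu_unit_eqI:
  fixes f :: "'a \<Rightarrow> nat"
  assumes v: "v \<in> verts G" "f v = 0"
    and le: "\<And>e. e \<in> arcs G \<Longrightarrow> f (tail G e) \<le> Suc (f (head G e))"
    and descent: "\<And>u. u \<in> verts G \<Longrightarrow> u \<noteq> v \<Longrightarrow>
      \<exists>e\<in>arcs G. tail G e = u \<and> f u = Suc (f (head G e))"
    and u: "u \<in> verts G"
  shows "\<mu> (\<lambda>_. 1) u v = ereal (real (f u))"
proof (rule antisym)
  have cost: "awalk_cost (\<lambda>_. 1) p = real (length p)" for p
    by (induction p) auto
  have "f u \<le> length p" if "awalk u p v" for p u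
    using that
  proof (induction p arbitrary: u)
    case Nil
    then show ?case using v by (simp add: awalk_Nil_iff)
  next
    case (Cons e p)
    then have "e \<in> arcs G" "tail G e = u" "awalk (head G e) p v"
      by (auto simp: awalk_Cons_iff)
    with Cons.IH[of "head G e"] le[of e] show ?case by simp
  qed
  then show "ereal (real (f u)) \<le> \<mu> (\<lambda>_. 1) u v"
    unfolding \<mu>_def by (intro INF_greatest) (auto simp: cost)
  \<comment> \<open>Always taking an arc that lowers \<open>f\<close> by one yields a walk of length
    \<open>f u\<close>; as descent is possible everywhere else, \<open>v\<close> is the only zero of
    \<open>f\<close>.\<close>
  have "\<exists>p. awalk u p v \<and> length p = f u"
    using u
  proof (induction "f u" arbitrary: u rule: less_induct)
    case less
    show ?case
    proof (cases "u = v")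
      case True
      then show ?thesis using v by (auto simp: awalk_Nil_iff intro!: exI[of _ "[]"])
    next
      case False
      then obtain e where e: "e \<in> arcs G" "tail G e = u" "f u = Suc (f (head G e))"
        using descent less.prems by blast
      then obtain p where "awalk (head G e) p v" "length p = f (head G e)"
        using less.hyps[of "head G e"] by auto
      with e show ?thesis by (intro exI[of _ "e # p"]) (auto simp: awalk_Cons_iff)
    qed
  qed
  then obtain p where p: "awalk u p v" "length p = f u" by blast
  then show "\<mu> (\<lambda>_. 1) u v \<le> ereal (real (f u))"
    using min_cost_le_walk_cost[OF p(1), of "\<lambda>_. 1"] by (simp add: cost)
qed

section \<open>Distances in the helm graph\<close>

definition rim_adj :: "nat \<Rightarrow> nat \<Rightarrow> nat \<Rightarrow> bool" where
  "rim_adj N i j \<longleftrightarrow> j = Suc i \<or> i = Suc j \<or> (i = 1 \<and> j = N) \<or> (i = N \<and> j = 1)"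

text \<open>The cap at 2 is the detour through the hub, which joins any two rim vertices.\<close>

definition rim_dist :: "nat \<Rightarrow> nat \<Rightarrow> nat \<Rightarrow> nat" where
  "rim_dist N i j = (if i = j then 0 else if rim_adj N i j then 1 else 2)"

text \<open>A pendant vertex is left only through its rim neighbour, so each pendant endpoint adds
  one; two equal pendants are the exception.\<close>

fun helm_dist :: "nat \<Rightarrow> helm_vertex \<Rightarrow> helm_vertex \<Rightarrow> nat" where
  "helm_dist N Hub Hub = 0"
| "helm_dist N Hub (Rim j) = 1"
| "helm_dist N Hub (Pendant j) = 2"
| "helm_dist N (Rim i) Hub = 1"
| "helm_dist N (Rim i) (Rim j) = rim_dist N i j"
| "helm_dist N (Rim i) (Pendant j) = Suc (rim_dist N i j)"
| "helm_dist N (Pendant i) Hub = 2"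
| "helm_dist N (Pendant i) (Rim j) = Suc (rim_dist N i j)"
| "helm_dist N (Pendant i) (Pendant j) = (if i = j then 0 else rim_dist N i j + 2)"

lemma helm_dist_commute: "helm_dist N u v = helm_dist N v u"
  by (cases u; cases v) (auto simp: rim_dist_def rim_adj_def)

lemma helm_dist_le_Suc:
  assumes "(u, w) \<in> parcs (helm_graph n)"
  shows "helm_dist (n - 1) u v \<le> Suc (helm_dist (n - 1) w v)"
  using assms
  by (cases v)
    (auto simp: helm_graph_def helm_edges_def wheel_edges_def rim_dist_def rim_adj_def)

text \<open>The witness is the next vertex of a shortest walk: a pendant steps to its rim vertex,
  the hub to the rim vertex at or below the target, and a rim vertex to the target's side if it is
  adjacent to it or below it, otherwise to the hub.\<close>

lemma helm_dist_descent:
  assumes "u \<in> pverts (helm_graph n)" "v \<in> pverts (helm_graph n)" "u \<noteq> v"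
  shows "\<exists>w. (u, w) \<in> parcs (helm_graph n) \<and> helm_dist (n - 1) u v = Suc (helm_dist (n - 1) w v)"
proof -
  have hub: "(Hub, Rim i) \<in> parcs (helm_graph n)" "(Rim i, Hub) \<in> parcs (helm_graph n)"
    and pendant: "(Rim i, Pendant i) \<in> parcs (helm_graph n)" "(Pendant i, Rim i) \<in> parcs (helm_graph n)"
    if "1 \<le> i" "i \<le> n - 1" for i
    using that by (auto simp: helm_graph_def helm_edges_def wheel_edges_def)
  have rim: "(Rim i, Rim j) \<in> parcs (helm_graph n)"
    if "rim_adj (n - 1) i j" "1 \<le> i" "i \<le> n - 1" "1 \<le> j" "j \<le> n - 1" for i j
    using that by (auto simp: helm_graph_def helm_edges_def wheel_edges_def rim_adj_def)
  show ?thesis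
  proof (cases u)
    case Hub
    show ?thesis
    proof (cases v)
      case (Rim j)
      then have "1 \<le> j" "j \<le> n - 1" using assms by (auto simp: helm_graph_def)
      with Rim Hub hub show ?thesis
        by (intro exI[of _ "Rim j"]) (auto simp: rim_dist_def)
    next
      case (Pendant j)
      then have "1 \<le> j" "j \<le> n - 1" using assms by (auto simp: helm_graph_def)
      with Pendant Hub hub show ?thesis
        by (intro exI[of _ "Rim j"]) (auto simp: rim_dist_def)
    qed (use Hub assms in auto)
  next
    case (Rim i)
    then have i: "1 \<le> i" "i \<le> n - 1" using assms by (auto simp: helm_graph_def)
    show ?thesis
    proof (cases v)
      case Hub
      with Rim i hub show ?thesis by (intro exI[of _ Hub]) auto
    next
      case v: (Rim j)
      then have "1 \<le> j" "j \<le> n - 1" using assms by (auto simp: helm_graph_def)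
      with v Rim i hub rim assms(3) show ?thesis
        by (intro exI[of _ "if rim_adj (n - 1) i j then Rim j else Hub"])
          (auto simp: rim_dist_def)
    next
      case (Pendant j)
      then have "1 \<le> j" "j \<le> n - 1" using assms by (auto simp: helm_graph_def)
      with Pendant Rim i hub rim pendant assms(3) show ?thesis
        by (intro exI[of _ "if i = j then Pendant j else if rim_adj (n - 1) i j then Rim j else Hub"])
          (auto simp: rim_dist_def)
    qed
  next
    case (Pendant i)
    then have "1 \<le> i" "i \<le> n - 1" using assms by (auto simp: helm_graph_def)
    with Pendant pendant assms(3) show ?thesis
      by (intro exI[of _ "Rim i"], cases v) auto
  qed
qed

lemma helm_graph_mu:
  assumes n: "n \<ge> 4" and u: "u \<in> pverts (helm_graph n)" and v: "v \<in> pverts (helm_graph n)"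
  shows "wf_digraph.\<mu> (with_proj (helm_graph n)) (\<lambda>_. 1) u v = ereal (real (helm_dist (n - 1) u v))"
proof -
  interpret pair_graph "helm_graph n" by (rule pair_graph_helm_graph[OF n])
  show ?thesis
  proof (rule mu_unit_eqI[where f = "\<lambda>u. helm_dist (n - 1) u v"])
    show "helm_dist (n - 1) v v = 0" by (cases v) (auto simp: rim_dist_def)
    show "helm_dist (n - 1) (fst e) v \<le> Suc (helm_dist (n - 1) (snd e) v)"
      if "e \<in> parcs (helm_graph n)" for e
      using that helm_dist_le_Suc[of "fst e" "snd e" n v] by simp
    show "\<exists>e\<in>parcs (helm_graph n). fst e = u \<and>
        helm_dist (n - 1) u v = Suc (helm_dist (n - 1) (snd e) v)"
      if "u \<in> pverts (helm_graph n)" "u \<noteq> v" for u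
      using helm_dist_descent[of u n v] that v by force
  qed (use u v in auto)
qed

lemma helm_dist_mat_index:
  assumes "N \<ge> 3" "i < 2 * N + 1" "j < 2 * N + 1"
  shows "helm_dist_mat (Suc N) $$ (i, j) =
    real (helm_dist N (helm_vertex_at (Suc N) i) (helm_vertex_at (Suc N) j))"
proof -
  have "helm_vertex_at (Suc N) k \<in> pverts (helm_graph (Suc N))" if "k < 2 * N + 1" for k
    using that by (auto simp: helm_vertex_at_def helm_graph_def image_iff)
  with assms show ?thesis
    by (simp add: helm_dist_mat_def helm_graph_mu)
qed

section \<open>Moore-Penrose inverses\<close>

text \<open>\<open>M * X\<close> and \<open>M * Y\<close> are symmetric projections onto the column
  space of \<open>M\<close>, so they agree; likewise \<open>X * M\<close> and \<open>Y * M\<close>.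
  Then \<open>X = Y * M * X = Y * M * Y = Y\<close>.\<close>

lemma is_MP_inverse_unique:
  assumes X: "is_MP_inverse M X" and Y: "is_MP_inverse M Y"
  shows "X = Y"
proof -
  let ?r = "dim_row M" and ?c = "dim_col M"
  have M: "M \<in> carrier_mat ?r ?c" by simp
  have Xc: "X \<in> carrier_mat ?c ?r" and Yc: "Y \<in> carrier_mat ?c ?r"
    using X Y by (auto simp: is_MP_inverse_def)
  have X1: "M * X * M = M" and X2: "X * M * X = X" and X3: "(M * X)\<^sup>T = M * X" and X4: "(X * M)\<^sup>T = X * M"
    using X by (auto simp: is_MP_inverse_def)
  have Y1: "M * Y * M = M" and Y2: "Y * M * Y = Y" and Y3: "(M * Y)\<^sup>T = M * Y" and Y4: "(Y * M)\<^sup>T = Y * M"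
    using Y by (auto simp: is_MP_inverse_def)
  have "M * X = (M * Y * M * X)" using Y1 by simp
  also have "\<dots> = (M * Y) * (M * X)"
    using M Xc Yc by (metis assoc_mult_mat mult_carrier_mat)
  \<comment> \<open>Transposition reverses the two symmetric factors, and in the reversed order
    \<open>M * X * M = M\<close> collapses the product to \<open>M * Y\<close>.\<close>
  also have "\<dots> = ((M * X) * (M * Y))\<^sup>T"
    using M Xc Yc X3 Y3 by (metis mult_carrier_mat transpose_mult)
  also have "(M * X) * (M * Y) = (M * X * M) * Y"
    using M Xc Yc by (metis assoc_mult_mat mult_carrier_mat)
  finally have MX: "M * X = M * Y" using X1 Y3 by simp
  have "X * M = X * (M * Y * M)" using Y1 by simp
  also have "\<dots> = (X * M) * (Y * M)"
    using M Xc Yc by (metis assoc_mult_mat mult_carrier_mat)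
  also have "\<dots> = ((Y * M) * (X * M))\<^sup>T"
    using M Xc Yc X4 Y4 by (metis mult_carrier_mat transpose_mult)
  also have "(Y * M) * (X * M) = Y * (M * X * M)"
    using M Xc Yc by (metis assoc_mult_mat mult_carrier_mat)
  finally have XM: "X * M = Y * M" using X1 Y4 by simp
  have "X = Y * M * X" using X2 XM by simp
  also have "\<dots> = Y * (M * X)" using M Xc Yc by (metis assoc_mult_mat)
  also have "\<dots> = Y * M * Y" using MX M Xc Yc by (metis assoc_mult_mat)
  finally show ?thesis using Y2 by simp
qed

lemma MP_inverse_eqI: "is_MP_inverse M X \<Longrightarrow> MP_inverse M = X"
  unfolding MP_inverse_def by (blast intro: is_MP_inverse_unique)

text \<open>Transposing the equation for \<open>M * X\<close> shows that \<open>X * M\<close> is the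
  same symmetric matrix. The two vanishing products say that multiplying \<open>M\<close> or
  \<open>X\<close> by it from the right changes nothing.\<close>

lemma is_MP_inverse_symmetricI:
  assumes M: "M \<in> carrier_mat k k" "M\<^sup>T = M" and X: "X \<in> carrier_mat k k" "X\<^sup>T = X"
    and Z: "Z \<in> carrier_mat k k" "Z\<^sup>T = Z"
    and MX: "M * X = 1\<^sub>m k - Z" and MZ: "M * Z = 0\<^sub>m k k" and XZ: "X * Z = 0\<^sub>m k k"
  shows "is_MP_inverse M X"
proof -
  have sym: "(1\<^sub>m k - Z)\<^sup>T = 1\<^sub>m k - Z"
    using Z by (metis one_carrier_mat transpose_minus transpose_one)
  have absorb: "A * (1\<^sub>m k - Z) = A" if "A \<in> carrier_mat k k" "A * Z = 0\<^sub>m k k" for A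
  proof -
    have "A * (1\<^sub>m k - Z) = A * 1\<^sub>m k - A * Z"
      using that Z by (intro mult_minus_distrib_mat) auto
    also have "\<dots> = A" using that by (intro eq_matI) auto
    finally show ?thesis .
  qed
  have "X * M = (M * X)\<^sup>T"
    using M X by (metis transpose_mult)
  then have XM: "X * M = 1\<^sub>m k - Z" using MX sym by simp
  have "M * X * M = M * (X * M)" using M X by (metis assoc_mult_mat)
  also have "\<dots> = M" using absorb[OF M(1) MZ] by (simp add: XM)
  finally have 1: "M * X * M = M" .
  have "X * M * X = X * (M * X)" using M X by (metis assoc_mult_mat)
  also have "\<dots> = X" using absorb[OF X(1) XZ] by (simp add: MX)
  finally show ?thesis
    using 1 M X sym unfolding is_MP_inverse_def by (auto simp: MX XM)
qed

section \<open>Splitting sums and indices into hub, rim and pendant blocks\<close>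

lemma sum_lessThan_add:
  fixes f :: "nat \<Rightarrow> 'a :: comm_monoid_add"
  shows "(\<Sum>k<a + b. f k) = (\<Sum>k<a. f k) + (\<Sum>k<b. f (a + k))"
  by (induction b) (auto simp: add.assoc)

lemma sum_helm_blocks:
  fixes f :: "nat \<Rightarrow> real"
  shows "(\<Sum>k<2 * N + 1. f k) = f 0 + (\<Sum>k<N. f (Suc k)) + (\<Sum>k<N. f (Suc (N + k)))"
proof -
  have "(\<Sum>k<2 * N + 1. f k) = (\<Sum>k<Suc (N + N). f k)" by (simp add: mult_2)
  also have "\<dots> = f 0 + (\<Sum>k<N + N. f (Suc k))" by (rule sum.lessThan_Suc_shift)
  finally show ?thesis by (simp add: sum_lessThan_add add.assoc)
qed

lemma helm_index_cases:
  assumes "i < 2 * N + 1"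
  obtains (Hub) "i = 0"
    | (Rim) a where "a < N" "i = Suc a"
    | (Pendant) a where "a < N" "i = Suc (N + a)"
proof -
  consider "i = 0" | "0 < i" "i \<le> N" | "N < i" by linarith
  then show thesis
  proof cases
    case 2
    then show thesis using that(2)[of "i - 1"] by simp
  next
    case 3
    then show thesis using that(3)[of "i - 1 - N"] assms by simp
  qed (use that(1) in simp)
qed

section \<open>The circulant \<open>S\<close> and the action of \<open>D\<close> on columns\<close>

text \<open>Cyclic positions count from 0, so position \<open>a\<close> belongs to
  \<open>Rim (Suc a)\<close>.\<close>

definition nxt :: "nat \<Rightarrow> nat \<Rightarrow> nat" where
  "nxt N a = (if Suc a = N then 0 else Suc a)"

definition prv :: "nat \<Rightarrow> nat \<Rightarrow> nat" where
  "prv N a = (if a = 0 then N - 1 else a - 1)"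

text \<open>The action of the matrix \<open>S = Circ(2,1,0,\<dots>,0,1)\<close> on column vectors.\<close>

definition circ_211 :: "nat \<Rightarrow> (nat \<Rightarrow> real) \<Rightarrow> nat \<Rightarrow> real" where
  "circ_211 N f a = 2 * f a + f (nxt N a) + f (prv N a)"

lemma circ_211_const [simp]: "circ_211 N (\<lambda>_. c) a = 4 * c"
  by (simp add: circ_211_def)

text \<open>Entry formulas are available only below \<open>N\<close>, and both cyclic neighbours of
  such a position stay below \<open>N\<close>.\<close>

lemma circ_211_cong: "a < N \<Longrightarrow> (\<And>k. k < N \<Longrightarrow> f k = g k) \<Longrightarrow> circ_211 N f a = circ_211 N g a"
  by (auto simp: circ_211_def nxt_def prv_def)

text \<open>Cyclic shifts permute the positions, so every column of \<open>S\<close> has sum 2 + 1 +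
  1.\<close>

lemma sum_circ_211: "(\<Sum>a<N. circ_211 N f a) = 4 * (\<Sum>a<N. f a)"
proof (cases N)
  case (Suc M)
  have "(\<Sum>a<N. f (nxt N a)) = (\<Sum>a<N. f a)"
    unfolding Suc by (subst (2) sum.lessThan_Suc_shift) (simp add: nxt_def)
  moreover have "(\<Sum>a<N. f (prv N a)) = (\<Sum>a<N. f a)"
    unfolding Suc by (subst sum.lessThan_Suc_shift) (simp add: prv_def)
  ultimately show ?thesis
    by (simp add: circ_211_def sum.distrib sum_distrib_left)
qed simp

text \<open>This is the rim block \<open>2 J - S\<close>. From \<open>N = 3\<close> on, a position
  and its two cyclic neighbours are distinct, so at most one correction applies.\<close>

lemma rim_dist_Suc:
  assumes "N \<ge> 3" "a < N" "k < N"
  shows "real (rim_dist N (Suc a) (Suc k)) =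
    2 - (if a = k then 2 else 0) - (if nxt N a = k then 1 else 0) - (if prv N a = k then 1 else 0)"
  using assms by (auto simp: rim_dist_def rim_adj_def nxt_def prv_def)

lemma sum_rim_dist:
  assumes "N \<ge> 3" "a < N"
  shows "(\<Sum>k<N. real (rim_dist N (Suc a) (Suc k)) * f k) = 2 * (\<Sum>k<N. f k) - circ_211 N f a"
proof -
  have "nxt N a < N" "prv N a < N" using assms by (auto simp: nxt_def prv_def)
  have "(\<Sum>k<N. real (rim_dist N (Suc a) (Suc k)) * f k) =
    (\<Sum>k<N. 2 * f k - (if a = k then 2 * f k else 0) - (if nxt N a = k then f k else 0)
       - (if prv N a = k then f k else 0))"
    using assms by (intro sum.cong) (auto simp: rim_dist_Suc algebra_simps)
  also have "\<dots> = 2 * (\<Sum>k<N. f k) - circ_211 N f a"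
    using assms \<open>nxt N a < N\<close> \<open>prv N a < N\<close>
    by (simp add: sum_subtractf sum_distrib_left circ_211_def)
  finally show ?thesis .
qed

text \<open>In the last block \<open>rim_dist + 2\<close> is too large by 2 exactly on the diagonal,
  which is the source of the term \<open>- 2 I\<close>.\<close>

lemma helm_dist_mat_blocks:
  assumes "N \<ge> 3"
  defines "D \<equiv> helm_dist_mat (Suc N)"
  shows "D $$ (0, 0) = 0"
    and "b < N \<Longrightarrow> D $$ (0, Suc b) = 1"
    and "b < N \<Longrightarrow> D $$ (0, Suc (N + b)) = 2"
    and "a < N \<Longrightarrow> D $$ (Suc a, 0) = 1"
    and "a < N \<Longrightarrow> b < N \<Longrightarrow> D $$ (Suc a, Suc b) = real (rim_dist N (Suc a) (Suc b))"
    and "a < N \<Longrightarrow> b < N \<Longrightarrow> D $$ (Suc a, Suc (N + b)) = real (rim_dist N (Suc a) (Suc b)) + 1"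
    and "a < N \<Longrightarrow> D $$ (Suc (N + a), 0) = 2"
    and "a < N \<Longrightarrow> b < N \<Longrightarrow> D $$ (Suc (N + a), Suc b) = real (rim_dist N (Suc a) (Suc b)) + 1"
    and "a < N \<Longrightarrow> b < N \<Longrightarrow> D $$ (Suc (N + a), Suc (N + b)) =
      real (rim_dist N (Suc a) (Suc b)) + 2 - (if a = b then 2 else 0)"
  using assms(1)
  by (auto simp: D_def helm_dist_mat_index helm_vertex_at_def rim_dist_def Suc_diff_le)

text \<open>Reduces every later product with \<open>D\<close> to the hub entry, the two block sums
  and the \<open>S\<close>-images of the two blocks of a column, plus one pendant entry in pendant
  rows.\<close>

lemma helm_dist_mat_apply:
  assumes "N \<ge> 3"
  defines "D \<equiv> helm_dist_mat (Suc N)"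
  shows "(\<Sum>k<2 * N + 1. D $$ (0, k) * f k) = (\<Sum>k<N. f (Suc k)) + 2 * (\<Sum>k<N. f (Suc (N + k)))"
    and "a < N \<Longrightarrow> (\<Sum>k<2 * N + 1. D $$ (Suc a, k) * f k) =
      f 0 + 2 * (\<Sum>k<N. f (Suc k)) - circ_211 N (\<lambda>k. f (Suc k)) a
        + 3 * (\<Sum>k<N. f (Suc (N + k))) - circ_211 N (\<lambda>k. f (Suc (N + k))) a"
    and "a < N \<Longrightarrow> (\<Sum>k<2 * N + 1. D $$ (Suc (N + a), k) * f k) =
      2 * f 0 + 3 * (\<Sum>k<N. f (Suc k)) - circ_211 N (\<lambda>k. f (Suc k)) a
        + 4 * (\<Sum>k<N. f (Suc (N + k))) - circ_211 N (\<lambda>k. f (Suc (N + k))) a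
        - 2 * f (Suc (N + a))"
  using assms(1) unfolding sum_helm_blocks D_def
  by (simp_all add: helm_dist_mat_blocks distrib_right left_diff_distrib sum.distrib sum_subtractf
      sum_rim_dist sum_distrib_left[symmetric] if_distrib[of "\<lambda>c. c * _"] cong: if_cong)

section \<open>Entries of \<open>L\<close> and \<open>w\<close>\<close>

text \<open>Since \<open>\<alpha>\<^sub>k = - (- 1)\<^sup>k q(k)\<close> with \<open>q(N - k) = q(k)\<close>, the vector \<open>x\<close> has the uniform entries
  \<open>\<delta>\<^sub>k\<^sub>0 - (- 1)\<^sup>k q(k) / (6N)\<close>, where \<open>N = 2m\<close>.\<close>

definition helm_q :: "nat \<Rightarrow> real \<Rightarrow> real" where
  "helm_q m d = 2 * (real m)\<^sup>2 + 7 - 6 * (real m - d)\<^sup>2"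

text \<open>By this symmetry \<open>helm_q\<close> depends only on cyclic distance, so entries that
  wrap around obey the same formula.\<close>

lemma helm_q_reflect: "helm_q m (2 * real m - d) = helm_q m d"
  by (simp add: helm_q_def power2_eq_square algebra_simps)

lemma helm_x_index:
  assumes "k < 2 * m"
  shows "helm_x (Suc (2 * m)) $ k = (if k = 0 then 1 else 0) - (- 1) ^ k * helm_q m k / (12 * m)"
proof -
  consider "k = 0" | "0 < k" "k \<le> m" | "m < k" by linarith
  then show ?thesis
  proof cases
    \<comment> \<open>Here \<open>helm_q m 0 = 7 - 4 m^2\<close>, and
      \<open>12 m - (7 - 4 m^2)\<close> equals \<open>n^2 + 4 n - 12\<close> for
      \<open>n = 2 m + 1\<close>.\<close>
    case 1
    with assms show ?thesis
      by (simp add: helm_x_def helm_q_def field_simps power2_eq_square)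
  next
    case 2
    with assms show ?thesis
      by (simp add: helm_x_def helm_alpha_def helm_q_def)
  next
    case 3
    have "even (2 * m - k) = even k" using assms by simp
    then have "(- 1) ^ (2 * m - k) = ((- 1) ^ k :: real)"
      by (simp add: minus_one_power_iff)
    moreover have "real (2 * m - k) = 2 * real m - real k" using assms by simp
    ultimately show ?thesis
      using 3 assms helm_q_reflect[of m k]
      by (simp add: helm_x_def helm_alpha_def helm_q_def)
  qed
qed

text \<open>For \<open>a > b\<close> the offset wraps to \<open>2 m - (a - b)\<close>: the even
  length keeps the sign, and reflection restores the distance.\<close>

lemma circ_helm_x_index:
  assumes "a < 2 * m" "b < 2 * m"
  shows "circ (helm_x (Suc (2 * m))) $$ (a, b) =
    (if a = b then 1 else 0) - (- 1) ^ (a + b) * helm_q m \<bar>real a - real b\<bar> / (12 * m)"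
proof -
  have dim: "dim_vec (helm_x (Suc (2 * m))) = 2 * m" by (simp add: helm_x_def Let_def)
  show ?thesis
  proof (cases "a \<le> b")
    case True
    then have "(b + 2 * m - a) mod (2 * m) = b - a"
      using assms by (metis Nat.add_diff_assoc2 add.commute less_imp_diff_less mod_add_self2 mod_less)
    moreover have "(- 1) ^ (b - a) = ((- 1) ^ (a + b) :: real)"
      using True by (simp add: minus_one_power_iff)
    ultimately show ?thesis
      using True assms by (auto simp: circ_def Let_def dim helm_x_index)
  next
    case False
    then have "(b + 2 * m - a) mod (2 * m) = b + 2 * m - a"
      using assms by simp
    moreover have "(- 1) ^ (b + 2 * m - a) = ((- 1) ^ (a + b) :: real)"
      using assms by (simp add: minus_one_power_iff)
    moreover have "helm_q m (b + 2 * m - a) = helm_q m \<bar>real a - real b\<bar>"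
      using False assms helm_q_reflect[of m "real a - real b"] by (simp add: algebra_simps)
    ultimately show ?thesis
      using False assms by (auto simp: circ_def Let_def dim helm_x_index simp del: of_nat_diff)
  qed
qed

text \<open>Since \<open>2 - n = 1 - N\<close>, the vector \<open>y\<close> is the alternating
  vector over \<open>N\<close> minus the first unit vector. Reduction modulo the even
  \<open>2 * m\<close> preserves parity, so the signs depend only on \<open>a + b\<close>.\<close>

lemma circ_helm_y_index:
  assumes "a < 2 * m" "b < 2 * m"
  shows "circ (helm_y (Suc (2 * m))) $$ (a, b) = (- 1) ^ (a + b) / (2 * m) - (if a = b then 1 else 0)"
proof -
  have dim: "dim_vec (helm_y (Suc (2 * m))) = 2 * m" by (simp add: helm_y_def)
  have y: "helm_y (Suc (2 * m)) $ k = (- 1) ^ k / (2 * m) - (if k = 0 then 1 else 0)"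
    if "k < 2 * m" for k
    using that by (simp add: helm_y_def field_simps)
  have "even ((b + 2 * m - a) mod (2 * m)) \<longleftrightarrow> even (a + b)"
    using assms by (auto simp: dvd_mod_iff)
  then have "(- 1) ^ ((b + 2 * m - a) mod (2 * m)) = ((- 1) ^ (a + b) :: real)"
    by (simp add: minus_one_power_iff)
  moreover have "(b + 2 * m - a) mod (2 * m) = 0 \<longleftrightarrow> a = b"
  proof (cases "a \<le> b")
    case True
    then have "(b + 2 * m - a) mod (2 * m) = b - a"
      using assms by (metis Nat.add_diff_assoc2 add.commute less_imp_diff_less mod_add_self2 mod_less)
    then show ?thesis using True by auto
  qed (use assms in auto)
  ultimately show ?thesis
    using assms by (simp add: circ_def Let_def dim y)
qed
lemma dim_circ [simp]: "dim_row (circ v) = dim_vec v" "dim_col (circ v) = dim_vec v"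
  by (simp_all add: circ_def Let_def)

lemma dim_helm_x [simp]: "dim_vec (helm_x n) = n - 1"
  by (simp add: helm_x_def Let_def)

lemma dim_helm_y [simp]: "dim_vec (helm_y n) = n - 1"
  by (simp add: helm_y_def)

lemma helm_L_blocks:
  assumes N: "N = 2 * m"
  defines "L \<equiv> helm_L (Suc N)"
  shows "L $$ (0, 0) = real N / 2"
    and "b < N \<Longrightarrow> L $$ (0, Suc b) = - 1 / 2"
    and "b < N \<Longrightarrow> L $$ (0, Suc (N + b)) = 0"
    and "a < N \<Longrightarrow> L $$ (Suc a, 0) = - 1 / 2"
    and "a < N \<Longrightarrow> b < N \<Longrightarrow> L $$ (Suc a, Suc b) =
      (if a = b then 1 else 0) - (- 1) ^ (a + b) * helm_q m \<bar>real a - real b\<bar> / (12 * m)"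
    and "a < N \<Longrightarrow> b < N \<Longrightarrow> L $$ (Suc a, Suc (N + b)) =
      (- 1) ^ (a + b) / (2 * m) - (if a = b then 1 else 0)"
    and "a < N \<Longrightarrow> L $$ (Suc (N + a), 0) = 0"
    and "a < N \<Longrightarrow> b < N \<Longrightarrow> L $$ (Suc (N + a), Suc b) =
      (- 1) ^ (a + b) / (2 * m) - (if a = b then 1 else 0)"
    and "a < N \<Longrightarrow> b < N \<Longrightarrow> L $$ (Suc (N + a), Suc (N + b)) = (if a = b then 1 else 0)"
  using circ_helm_x_index[where m = m, folded N] circ_helm_y_index[where m = m, folded N]
  by (simp_all add: L_def helm_L_def Let_def ones_vec_def mat_of_row_def)

lemma helm_w_blocks:
  fixes N :: nat
  defines "w \<equiv> helm_w (Suc N)"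
  shows "w $ 0 = (4 - real N) / 4"
    and "a < N \<Longrightarrow> w $ Suc a = - 1 / 4"
    and "a < N \<Longrightarrow> w $ Suc (N + a) = 1 / 2"
  by (simp_all add: w_def helm_w_def ones_vec_def)

section \<open>Alternating vectors and quadratics under \<open>S\<close>\<close>

lemma sum_alternating: "(\<Sum>k<2 * m. (- 1) ^ (k + b)) = (0 :: real)"
  by (induction m) (simp_all add: power_add)

text \<open>On an even cycle both neighbours have the opposite parity, so the weights 2, 1, 1
  cancel.\<close>

lemma circ_211_alternating:
  assumes "a < 2 * m"
  shows "circ_211 (2 * m) (\<lambda>k. (- 1) ^ (k + b)) a = 0"
proof -
  have "even (nxt (2 * m) a) \<longleftrightarrow> odd a" "even (prv (2 * m) a) \<longleftrightarrow> odd a"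
    using assms by (auto simp: nxt_def prv_def) presburger+
  then show ?thesis by (auto simp: circ_211_def minus_one_power_iff)
qed

text \<open>Entries of \<open>S\<close> stay in the form \<open>2 - rim_dist\<close>, so that the
  two halves of a column of \<open>L\<close> can cancel without case splits.\<close>

lemma circ_211_delta:
  assumes "N \<ge> 3" "a < N" "b < N"
  shows "circ_211 N (\<lambda>k. if k = b then c else 0) a = c * (2 - real (rim_dist N (Suc a) (Suc b)))"
  using assms by (auto simp: circ_211_def rim_dist_Suc)

text \<open>The sign change between neighbours turns \<open>S\<close> into minus a second
  difference, which is 12 for leading term \<open>- 6 d^2\<close>. The kink of the absolute value at
  \<open>a = b\<close> contributes \<open>- 24 m\<close>.\<close>

lemma circ_211_helm_q:
  assumes "a < 2 * m" "b < 2 * m"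
  shows "circ_211 (2 * m) (\<lambda>k. (- 1) ^ (k + b) * helm_q m \<bar>real k - real b\<bar>) a =
    12 * (- 1) ^ (a + b) - (if a = b then 24 * real m else 0 :: real)"
proof -
  have "even (nxt (2 * m) a) \<longleftrightarrow> odd a" "even (prv (2 * m) a) \<longleftrightarrow> odd a"
    using assms by (auto simp: nxt_def prv_def) presburger+
  then have sgn: "(- 1) ^ (nxt (2 * m) a + b) = - ((- 1) ^ (a + b) :: real)"
    "(- 1) ^ (prv (2 * m) a + b) = - ((- 1) ^ (a + b) :: real)"
    by (auto simp: minus_one_power_iff)
  \<comment> \<open>At the seam of the cycle the neighbour jumps to the other end;
    \<open>helm_q_reflect\<close> shows that the value is the one of the unwrapped position.\<close>
  have fwd: "helm_q m \<bar>real (nxt (2 * m) a) - real b\<bar> = helm_q m \<bar>real a + 1 - real b\<bar>"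
  proof (cases "Suc a = 2 * m")
    case True
    then have "\<bar>real a + 1 - real b\<bar> = 2 * real m - real b" using assms by linarith
    with True show ?thesis using helm_q_reflect[of m b] by (simp add: nxt_def)
  qed (simp add: nxt_def add.commute)
  have bwd: "helm_q m \<bar>real (prv (2 * m) a) - real b\<bar> = helm_q m \<bar>real a - 1 - real b\<bar>"
  proof (cases "a = 0")
    case True
    then have "\<bar>real (prv (2 * m) a) - real b\<bar> = 2 * real m - (1 + real b)"
      using assms by (simp add: prv_def of_nat_diff)
    with True show ?thesis using helm_q_reflect[of m "1 + real b"] by (simp add: add.commute)
  qed (simp add: prv_def of_nat_diff)
  define s :: real where "s = (- 1) ^ (a + b)"
  have "circ_211 (2 * m) (\<lambda>k. (- 1) ^ (k + b) * helm_q m \<bar>real k - real b\<bar>) a =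
      s * (2 * helm_q m \<bar>real a - real b\<bar> - helm_q m \<bar>real a + 1 - real b\<bar> - helm_q m \<bar>real a - 1 - real b\<bar>)"
    unfolding circ_211_def sgn fwd bwd by (simp add: s_def algebra_simps)
  also have "\<dots> = s * (12 - (if a = b then 24 * real m else 0))"
  proof -
    \<comment> \<open>Distinct integers differ by at least 1, so off the diagonal neither shift
      crosses the kink.\<close>
    consider "a = b" | "real a \<ge> real b + 1" | "real a + 1 \<le> real b" by linarith
    then show ?thesis
      by cases (simp_all add: helm_q_def power2_eq_square algebra_simps)
  qed
  finally show ?thesis by (auto simp: s_def algebra_simps)
qed

lemma sum_shifted_squares:
  fixes t :: real
  shows "6 * (\<Sum>k<K. (real k - t)\<^sup>2) = real K * (real K - 1) * (2 * real K - 1)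
    - 6 * t * real K * (real K - 1) + 6 * t\<^sup>2 * real K"
  by (induction K) (simp_all add: power2_eq_square algebra_simps)

text \<open>Divided by \<open>12 * m\<close>, this total cancels the identity part of
  \<open>A\<close> in \<open>L z\<close>.\<close>

lemma sum_helm_q:
  assumes "a < 2 * m"
  shows "(\<Sum>k<2 * m. helm_q m \<bar>real a - real k\<bar>) = 12 * m"
proof -
  \<comment> \<open>The absolute value changes branch at \<open>a\<close>. The upper range is
    written as a difference of two initial segments, to which \<open>sum_shifted_squares\<close>
    applies.\<close>
  have split: "(\<Sum>k<2 * m. g k) = (\<Sum>k<a. g k) + ((\<Sum>k<2 * m. h k) - (\<Sum>k<a. h k))"
    if "\<And>k. a \<le> k \<Longrightarrow> g k = h k" for g h :: "nat \<Rightarrow> real"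
    using sum_lessThan_add[of g a "2 * m - a"] sum_lessThan_add[of h a "2 * m - a"] assms that by simp
  have "(\<Sum>k<2 * m. (real m - \<bar>real a - real k\<bar>)\<^sup>2) =
    (\<Sum>k<a. (real m - \<bar>real a - real k\<bar>)\<^sup>2) +
      ((\<Sum>k<2 * m. (real k - (real a + real m))\<^sup>2) - (\<Sum>k<a. (real k - (real a + real m))\<^sup>2))"
    by (rule split) (simp add: power2_eq_square algebra_simps)
  also have "(\<Sum>k<a. (real m - \<bar>real a - real k\<bar>)\<^sup>2) = (\<Sum>k<a. (real k - (real a - real m))\<^sup>2)"
    by (intro sum.cong) (auto simp: power2_eq_square algebra_simps)
  finally have squares: "(\<Sum>k<2 * m. (real m - \<bar>real a - real k\<bar>)\<^sup>2) =
    (\<Sum>k<a. (real k - (real a - real m))\<^sup>2) +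
      ((\<Sum>k<2 * m. (real k - (real a + real m))\<^sup>2) - (\<Sum>k<a. (real k - (real a + real m))\<^sup>2))" .
  have "6 * (\<Sum>k<2 * m. (real m - \<bar>real a - real k\<bar>)\<^sup>2) = 4 * real m ^ 3 + 2 * m"
    unfolding squares distrib_left right_diff_distrib sum_shifted_squares
    by (simp add: power2_eq_square power3_eq_cube algebra_simps)
  moreover have "(\<Sum>k<2 * m. helm_q m \<bar>real a - real k\<bar>) =
      2 * m * (2 * (real m)\<^sup>2 + 7) - 6 * (\<Sum>k<2 * m. (real m - \<bar>real a - real k\<bar>)\<^sup>2)"
    by (simp add: helm_q_def sum_subtractf sum_distrib_left[symmetric])
  ultimately show ?thesis
    by (simp add: power2_eq_square power3_eq_cube algebra_simps)
qed

section \<open>Products of \<open>D\<close>, \<open>L\<close>, \<open>w\<close> and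
  \<open>z\<close>\<close>

text \<open>The exponent \<open>k - 1\<close> gives cyclic position \<open>a\<close> the sign
  \<open>(-1)^a\<close>. The squared norm is \<open>N\<close>, so \<open>z z' / N\<close> is the
  orthogonal projection onto the line of \<open>z\<close>.\<close>

definition helm_z :: "nat \<Rightarrow> nat \<Rightarrow> real" where
  "helm_z N k = (if k = 0 \<or> N < k then 0 else (- 1) ^ (k - 1))"

lemma helm_z_blocks:
  "helm_z N 0 = 0"
  "a < N \<Longrightarrow> helm_z N (Suc a) = (- 1) ^ a"
  "helm_z N (Suc (N + a)) = 0"
  by (simp_all add: helm_z_def)

lemma sum_neg_one_power: "(\<Sum>k<2 * m. (- 1) ^ k) = (0 :: real)"
  using sum_alternating[of 0 m] by simp

context
  fixes m N :: nat
  assumes m: "m \<ge> 2" and N: "N = 2 * m"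
begin

lemma dist_mult_z: "i < 2 * N + 1 \<Longrightarrow> (\<Sum>k<2 * N + 1. helm_dist_mat (Suc N) $$ (i, k) * helm_z N k) = 0"
proof -
  assume "i < 2 * N + 1"
  have N3: "N \<ge> 3" using m N by simp
  have z: "circ_211 N (\<lambda>k. helm_z N (Suc k)) a = 0" if "a < N" for a
    using circ_211_alternating[of a m 0] that N circ_211_cong[OF that, of "\<lambda>k. helm_z N (Suc k)" "\<lambda>k. (- 1) ^ (k + 0)"]
    by (simp add: helm_z_blocks)
  show ?thesis
    using \<open>i < 2 * N + 1\<close>
    by (cases rule: helm_index_cases)
      (simp_all only: helm_dist_mat_apply[OF N3], simp_all add: z helm_z_blocks sum_neg_one_power[of m, folded N])
qed

lemma dist_mult_w: "i < 2 * N + 1 \<Longrightarrow>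
  (\<Sum>k<2 * N + 1. helm_dist_mat (Suc N) $$ (i, k) * helm_w (Suc N) $ k) = 3 * real N / 4"
proof -
  assume "i < 2 * N + 1"
  have N3: "N \<ge> 3" using m N by simp
  \<comment> \<open>\<open>w\<close> is constant on each block, and \<open>S\<close> multiplies
    constants by 4.\<close>
  have w: "circ_211 N (\<lambda>k. helm_w (Suc N) $ Suc k) a = - 1" "circ_211 N (\<lambda>k. helm_w (Suc N) $ Suc (N + k)) a = 2"
    if "a < N" for a
    using circ_211_cong[OF that, of "\<lambda>k. helm_w (Suc N) $ Suc k" "\<lambda>_. - 1 / 4"]
      circ_211_cong[OF that, of "\<lambda>k. helm_w (Suc N) $ Suc (N + k)" "\<lambda>_. 1 / 2"]
    by (simp_all add: helm_w_blocks)
  show ?thesis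
    using \<open>i < 2 * N + 1\<close>
    by (cases rule: helm_index_cases)
      (simp_all only: helm_dist_mat_apply[OF N3], simp_all add: w helm_w_blocks, simp_all add: field_simps)
qed

lemma w_mult_z: "(\<Sum>k<2 * N + 1. helm_w (Suc N) $ k * helm_z N k) = 0"
  unfolding sum_helm_blocks
  by (simp add: helm_z_blocks helm_w_blocks sum_negf sum_divide_distrib[symmetric] sum_neg_one_power[of m, folded N])

text \<open>The hub row is constant on the rim, where \<open>z\<close> sums to zero. In rim rows the
  signs combine and leave the sum of \<open>helm_q\<close>; in pendant rows the alternating part of
  \<open>B\<close> reproduces \<open>z\<close> and its part \<open>- I\<close> removes it.\<close>

lemma L_mult_z: "i < 2 * N + 1 \<Longrightarrow> (\<Sum>k<2 * N + 1. helm_L (Suc N) $$ (i, k) * helm_z N k) = 0"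
proof -
  assume "i < 2 * N + 1"
  then show ?thesis
  proof (cases rule: helm_index_cases)
    case Hub
    then show ?thesis
      unfolding sum_helm_blocks
      by (simp add: helm_z_blocks helm_L_blocks[OF N] sum_negf sum_divide_distrib[symmetric] sum_neg_one_power[of m, folded N])
  next
    case (Rim a)
    have "(\<Sum>k<N. helm_L (Suc N) $$ (Suc a, Suc k) * helm_z N (Suc k)) =
      (\<Sum>k<N. (if a = k then (- 1) ^ a else 0) - (- 1) ^ a * helm_q m \<bar>real a - real k\<bar> / (12 * m))"
      using Rim by (intro sum.cong) (auto simp: helm_L_blocks[OF N] helm_z_blocks algebra_simps power_add)
    also have "\<dots> = 0"
      using Rim m sum_helm_q[of a m, folded N]
      by (simp add: sum_subtractf sum_divide_distrib[symmetric] sum_distrib_left[symmetric])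
    finally show ?thesis
      unfolding sum_helm_blocks using Rim by (simp add: helm_z_blocks)
  next
    case (Pendant a)
    have "(\<Sum>k<N. helm_L (Suc N) $$ (Suc (N + a), Suc k) * helm_z N (Suc k)) =
      (\<Sum>k<N. (- 1) ^ a / (2 * m) - (if a = k then (- 1) ^ a else 0))"
      using Pendant by (intro sum.cong) (auto simp: helm_L_blocks[OF N] helm_z_blocks algebra_simps power_add)
    also have "\<dots> = 0"
      using Pendant m N by (simp add: sum_subtractf)
    finally show ?thesis
      unfolding sum_helm_blocks using Pendant by (simp add: helm_z_blocks)
  qed
qed

text \<open>Collects what \<open>helm_dist_mat_apply\<close> needs about the rim and pendant columns
  of \<open>L\<close>.\<close>

lemma L_col_sums:
  assumes b: "b < N"
  shows "(\<Sum>k<N. helm_L (Suc N) $$ (Suc k, Suc b)) = 3 / 2"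
    and "(\<Sum>k<N. helm_L (Suc N) $$ (Suc (N + k), Suc b)) = - 1"
    and "(\<Sum>k<N. helm_L (Suc N) $$ (Suc k, Suc (N + b))) = - 1"
    and "(\<Sum>k<N. helm_L (Suc N) $$ (Suc (N + k), Suc (N + b))) = 1"
    and "a < N \<Longrightarrow> circ_211 N (\<lambda>k. helm_L (Suc N) $$ (Suc k, Suc b)) a =
      2 - real (rim_dist N (Suc a) (Suc b)) - (- 1) ^ (a + b) / m + (if a = b then 2 else 0)"
    and "a < N \<Longrightarrow> circ_211 N (\<lambda>k. helm_L (Suc N) $$ (Suc (N + k), Suc b)) a =
      - (2 - real (rim_dist N (Suc a) (Suc b)))"
    and "a < N \<Longrightarrow> circ_211 N (\<lambda>k. helm_L (Suc N) $$ (Suc k, Suc (N + b))) a =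
      - (2 - real (rim_dist N (Suc a) (Suc b)))"
    and "a < N \<Longrightarrow> circ_211 N (\<lambda>k. helm_L (Suc N) $$ (Suc (N + k), Suc (N + b))) a =
      2 - real (rim_dist N (Suc a) (Suc b))"
proof -
  have N3: "N \<ge> 3" using m N by simp
  have alt: "(\<Sum>k<N. (- 1) ^ (k + b) / (2 * m)) = 0"
    by (simp add: N sum_divide_distrib[symmetric] sum_alternating)
  define q :: "nat \<Rightarrow> real" where "q k = (- 1) ^ (k + b) * helm_q m \<bar>real k - real b\<bar>" for k
  have q: "circ_211 N q a = 12 * (- 1) ^ (a + b) - (if a = b then 24 * real m else 0)" if "a < N" for a
    using circ_211_helm_q[of a m b] that b unfolding N q_def by simp
  \<comment> \<open>The alternating sum of \<open>helm_q\<close> is read off from its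
    \<open>S\<close>-image, since \<open>S\<close> multiplies totals by 4.\<close>
  have "4 * (\<Sum>k<N. q k) = (\<Sum>a<N. 12 * (- 1) ^ (a + b) - (if a = b then 24 * real m else 0))"
    unfolding sum_circ_211[symmetric] by (intro sum.cong) (auto simp: q)
  also have "\<dots> = - 24 * m"
    using b by (simp add: sum_subtractf sum_distrib_left[symmetric] N sum_alternating)
  finally have sum_q: "(\<Sum>k<N. q k) = - 6 * m" by simp
  have L: "helm_L (Suc N) $$ (Suc k, Suc b) = (if k = b then 1 else 0) - q k / (12 * m)" if "k < N" for k
    using that b by (simp add: helm_L_blocks[OF N] q_def)
  show "(\<Sum>k<N. helm_L (Suc N) $$ (Suc k, Suc b)) = 3 / 2"
    using b m by (simp add: L sum_subtractf sum_divide_distrib[symmetric] sum_q)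
  show "(\<Sum>k<N. helm_L (Suc N) $$ (Suc (N + k), Suc b)) = - 1"
    "(\<Sum>k<N. helm_L (Suc N) $$ (Suc k, Suc (N + b))) = - 1"
    "(\<Sum>k<N. helm_L (Suc N) $$ (Suc (N + k), Suc (N + b))) = 1"
    using b alt by (simp_all add: helm_L_blocks[OF N] sum_subtractf)
  have lin: "circ_211 N (\<lambda>k. c * f k + d * g k) a = c * circ_211 N f a + d * circ_211 N g a" for c d f g a
    by (simp add: circ_211_def algebra_simps)
  let ?\<delta> = "\<lambda>k. if k = b then 1 else 0 :: real" and ?alt = "\<lambda>k. (- 1) ^ (k + b) :: real"
  assume a: "a < N"
  note \<delta> = circ_211_delta[OF N3 a b, of 1] and alt = circ_211_alternating[of a m b, folded N, OF a]
  have "circ_211 N (\<lambda>k. helm_L (Suc N) $$ (Suc k, Suc b)) a =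
      circ_211 N (\<lambda>k. 1 * ?\<delta> k + (- 1 / (12 * m)) * q k) a"
    by (rule circ_211_cong[OF a]) (simp add: L)
  then show "circ_211 N (\<lambda>k. helm_L (Suc N) $$ (Suc k, Suc b)) a =
      2 - real (rim_dist N (Suc a) (Suc b)) - (- 1) ^ (a + b) / m + (if a = b then 2 else 0)"
    unfolding lin \<delta> q[OF a] using m by (auto simp: field_simps)
  have "circ_211 N (\<lambda>k. helm_L (Suc N) $$ (Suc (N + k), Suc b)) a =
      circ_211 N (\<lambda>k. (- 1) * ?\<delta> k + (1 / (2 * m)) * ?alt k) a"
    by (rule circ_211_cong[OF a]) (simp add: helm_L_blocks[OF N] b)
  then show "circ_211 N (\<lambda>k. helm_L (Suc N) $$ (Suc (N + k), Suc b)) a =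
      - (2 - real (rim_dist N (Suc a) (Suc b)))"
    unfolding lin \<delta> alt by simp
  have "circ_211 N (\<lambda>k. helm_L (Suc N) $$ (Suc k, Suc (N + b))) a =
      circ_211 N (\<lambda>k. (- 1) * ?\<delta> k + (1 / (2 * m)) * ?alt k) a"
    by (rule circ_211_cong[OF a]) (simp add: helm_L_blocks[OF N] b)
  then show "circ_211 N (\<lambda>k. helm_L (Suc N) $$ (Suc k, Suc (N + b))) a =
      - (2 - real (rim_dist N (Suc a) (Suc b)))"
    unfolding lin \<delta> alt by simp
  have "circ_211 N (\<lambda>k. helm_L (Suc N) $$ (Suc (N + k), Suc (N + b))) a = circ_211 N ?\<delta> a"
    by (rule circ_211_cong[OF a]) (simp add: helm_L_blocks[OF N] b)
  then show "circ_211 N (\<lambda>k. helm_L (Suc N) $$ (Suc (N + k), Suc (N + b))) a =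
      2 - real (rim_dist N (Suc a) (Suc b))"
    unfolding \<delta> by simp
qed

text \<open>In a rim column the \<open>S\<close>-images of the two halves cancel up to an
  alternating and a diagonal term; these give \<open>z z'\<close> and \<open>I\<close> in rim rows,
  and the term \<open>- 2 I\<close> of \<open>D\<close> adjusts them in pendant rows. In a pendant
  column the images cancel completely.\<close>

lemma dist_mult_L:
  assumes i: "i < 2 * N + 1" and j: "j < 2 * N + 1"
  shows "(\<Sum>k<2 * N + 1. helm_dist_mat (Suc N) $$ (i, k) * helm_L (Suc N) $$ (k, j)) =
    2 * helm_w (Suc N) $ j - 2 * (if i = j then 1 else 0) + 2 * helm_z N i * helm_z N j / N"
proof -
  have N3: "N \<ge> 3" using m N by simp
  have hub: "circ_211 N (\<lambda>k. helm_L (Suc N) $$ (Suc k, 0)) a = - 2"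
    "circ_211 N (\<lambda>k. helm_L (Suc N) $$ (Suc (N + k), 0)) a = 0" if "a < N" for a
    using circ_211_cong[OF that, of "\<lambda>k. helm_L (Suc N) $$ (Suc k, 0)" "\<lambda>_. - 1 / 2"]
      circ_211_cong[OF that, of "\<lambda>k. helm_L (Suc N) $$ (Suc (N + k), 0)" "\<lambda>_. 0"]
    by (simp_all add: helm_L_blocks[OF N])
  have hub_sums: "(\<Sum>k<N. helm_L (Suc N) $$ (Suc k, 0)) = - real m"
    "(\<Sum>k<N. helm_L (Suc N) $$ (Suc (N + k), 0)) = 0"
    by (simp_all add: helm_L_blocks[OF N]) (simp add: N)
  note columns = helm_dist_mat_apply[OF N3] hub hub_sums L_col_sums
  note blocks = helm_w_blocks helm_z_blocks helm_L_blocks[OF N]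
  show ?thesis
    using j
  proof (cases rule: helm_index_cases)
    case Hub
    show ?thesis
      using i by (cases rule: helm_index_cases) (insert Hub, simp_all only: columns,
          simp_all add: blocks, simp_all add: N field_simps)
  next
    case (Rim b)
    show ?thesis
      using i by (cases rule: helm_index_cases)
        (insert Rim, simp_all only: columns,
          simp_all add: blocks power_add, simp_all add: N field_simps)
  next
    case (Pendant b)
    show ?thesis
      using i by (cases rule: helm_index_cases)
        (insert Pendant, simp_all only: columns,
          simp_all add: blocks power_add)
  qed
qed

section \<open>The Penrose equations for the claimed inverse\<close>

lemma is_MP_inverse_helm_dist_mat:
  fixes D X :: "real mat"
  defines "D \<equiv> helm_dist_mat (Suc N)"
    and "X \<equiv> (- (1 / 2)) \<cdot>\<^sub>m helm_L (Suc N)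
      + (4 / (3 * real N)) \<cdot>\<^sub>m ((mat_of_row (helm_w (Suc N)))\<^sup>T * mat_of_row (helm_w (Suc N)))"
  shows "is_MP_inverse D X"
proof (rule is_MP_inverse_symmetricI)
  let ?k = "2 * N + 1"
  let ?w = "\<lambda>i. helm_w (Suc N) $ i" and ?L = "\<lambda>i j. helm_L (Suc N) $$ (i, j)" and ?z = "helm_z N"
  define Z :: "real mat" where "Z = mat ?k ?k (\<lambda>(i, j). ?z i * ?z j / N)"
  have N3: "N \<ge> 3" using m N by simp
  have D: "D \<in> carrier_mat ?k ?k" by (simp add: D_def helm_dist_mat_def)
  have dims: "dim_row (helm_L (Suc N)) = ?k" "dim_col (helm_L (Suc N)) = ?k" "dim_vec (helm_w (Suc N)) = ?k"
    by (simp_all add: helm_L_def helm_w_def ones_vec_def Let_def)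
  then have X: "X \<in> carrier_mat ?k ?k" by (intro carrier_matI) (simp_all add: X_def)
  have Z: "Z \<in> carrier_mat ?k ?k" by (simp add: Z_def)
  have X_index: "X $$ (i, j) = - ?L i j / 2 + 4 / (3 * N) * (?w i * ?w j)" if "i < ?k" "j < ?k" for i j
    using that dims by (simp add: X_def scalar_prod_def mat_of_row_def)
  have mult_index: "(P * Q) $$ (i, j) = (\<Sum>k<?k. P $$ (i, k) * Q $$ (k, j))"
    if "P \<in> carrier_mat ?k ?k" "Q \<in> carrier_mat ?k ?k" "i < ?k" "j < ?k" for P Q :: "real mat" and i j
    using that by (auto simp: scalar_prod_def atLeast0LessThan intro!: sum.cong)
  have L_sym: "?L i j = ?L j i" if "i < ?k" "j < ?k" for i j
    using that(1)
  proof (cases rule: helm_index_cases)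
    case Hub
    show ?thesis using that(2) by (cases rule: helm_index_cases) (insert Hub, auto simp: helm_L_blocks[OF N])
  next
    case (Rim a)
    show ?thesis using that(2)
      by (cases rule: helm_index_cases)
        (insert Rim, auto simp: helm_L_blocks[OF N] add.commute[of a] abs_minus_commute)
  next
    case (Pendant a)
    show ?thesis using that(2)
      by (cases rule: helm_index_cases) (insert Pendant, auto simp: helm_L_blocks[OF N] add.commute[of a])
  qed
  show "D \<in> carrier_mat ?k ?k" "X \<in> carrier_mat ?k ?k" "Z \<in> carrier_mat ?k ?k" by fact+
  show "D\<^sup>T = D"
  proof (rule eq_matI)
    fix i j
    assume "i < dim_row D" "j < dim_col D"
    then have "i < ?k" "j < ?k" using D by auto
    then show "D\<^sup>T $$ (i, j) = D $$ (i, j)"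
      using D unfolding D_def
      by (simp add: helm_dist_mat_index[OF N3] helm_dist_commute[of N "helm_vertex_at (Suc N) i"])
  qed (use D in auto)
  show "X\<^sup>T = X"
    using X by (intro eq_matI) (auto simp: X_index L_sym mult.commute)
  show "Z\<^sup>T = Z"
    by (rule eq_matI) (auto simp: Z_def)
  show "D * X = 1\<^sub>m ?k - Z"
  proof (rule eq_matI)
    fix i j
    assume "i < dim_row (1\<^sub>m ?k - Z)" "j < dim_col (1\<^sub>m ?k - Z)"
    then have ij: "i < ?k" "j < ?k" using Z by auto
    have "(D * X) $$ (i, j) =
      (\<Sum>k<?k. - (1 / 2) * (D $$ (i, k) * ?L k j) + 4 / (3 * N) * ?w j * (D $$ (i, k) * ?w k))"
      unfolding mult_index[OF D X ij] using ij by (intro sum.cong) (auto simp: X_index algebra_simps)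
    \<comment> \<open>The coefficient \<open>4 / (3 * N)\<close> is the reciprocal of the constant
      entry of \<open>D w\<close>, so the rank-one part contributes exactly \<open>e w'\<close>,
      cancelling \<open>- e w'\<close> from \<open>- D L / 2\<close>.\<close>
    also have "\<dots> = - (1 / 2) * (2 * ?w j - 2 * (if i = j then 1 else 0) + 2 * ?z i * ?z j / N)
        + 4 / (3 * N) * ?w j * (3 * real N / 4)"
      unfolding sum.distrib sum_distrib_left[symmetric] D_def dist_mult_L[OF ij] dist_mult_w[OF ij(1)] ..
    also have "\<dots> = (1\<^sub>m ?k - Z) $$ (i, j)"
      using ij N3 Z by (simp add: Z_def field_simps)
    finally show "(D * X) $$ (i, j) = (1\<^sub>m ?k - Z) $$ (i, j)" .
  qed (use D X Z in auto)
  show "D * Z = 0\<^sub>m ?k ?k"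
  proof (rule eq_matI)
    fix i j
    assume "i < dim_row (0\<^sub>m ?k ?k :: real mat)" "j < dim_col (0\<^sub>m ?k ?k :: real mat)"
    then have ij: "i < ?k" "j < ?k" by auto
    have "(D * Z) $$ (i, j) = (\<Sum>k<?k. ?z j / N * (D $$ (i, k) * ?z k))"
      unfolding mult_index[OF D Z ij] using ij by (intro sum.cong) (auto simp: Z_def)
    also have "\<dots> = 0"
      unfolding sum_distrib_left[symmetric] D_def dist_mult_z[OF ij(1)] by simp
    finally show "(D * Z) $$ (i, j) = 0\<^sub>m ?k ?k $$ (i, j)" using ij by simp
  qed (use D Z in auto)
  show "X * Z = 0\<^sub>m ?k ?k"
  proof (rule eq_matI)
    fix i j
    assume "i < dim_row (0\<^sub>m ?k ?k :: real mat)" "j < dim_col (0\<^sub>m ?k ?k :: real mat)"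
    then have ij: "i < ?k" "j < ?k" by auto
    have "(X * Z) $$ (i, j) =
      (\<Sum>k<?k. - ?z j / (2 * N) * (?L i k * ?z k) + 4 / (3 * N) * ?w i * ?z j / N * (?w k * ?z k))"
      unfolding mult_index[OF X Z ij] using ij N3
      by (intro sum.cong) (auto simp: Z_def X_index field_simps)
    also have "\<dots> = 0"
      unfolding sum.distrib sum_distrib_left[symmetric] L_mult_z[OF ij(1)] w_mult_z by simp
    finally show "(X * Z) $$ (i, j) = 0\<^sub>m ?k ?k $$ (i, j)" using ij by simp
  qed (use X Z in auto)
qed

end

theorem theorem4p13:
  fixes n :: nat
  assumes "n \<ge> 5" and "odd n"
  shows "MP_inverse (helm_dist_mat n) =
    (- (1 / 2)) \<cdot>\<^sub>m helm_L n
      + (4 / (3 * (real n - 1))) \<cdot>\<^sub>m ((mat_of_row (helm_w n))\<^sup>T * mat_of_row (helm_w n))"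
proof -
  from \<open>odd n\<close> obtain m where n: "n = Suc (2 * m)" by (auto elim: oddE)
  then have "m \<ge> 2" using \<open>n \<ge> 5\<close> by simp
  from MP_inverse_eqI[OF is_MP_inverse_helm_dist_mat[OF this refl]] show ?thesis
    by (simp add: n)
qed

end
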